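(* Let $c\neq 0$ and $\lambda>0$ be real constants, let $I\subset\mathbb{R}$ be an open interval on which $\cos\left(\frac{u}{c}\right)\neq0$ and $1-\frac{\lambda^2}{c^2}\sin^2\left(\frac{u}{c}\right)>0$, and let $\alpha:I\to\mathbb{R}$ be a smooth function. Then the generalized spherical surface of first kind in $\mathbb{E}^4$ determined by $c,\lambda,\alpha$ has constant Gaussian curvature $K=1/c^2$.
   Context: The generalized spherical surface of first kind determined by $c,\lambda,\alpha$ is the surface in $\mathbb{E}^4$ given by the patch $$X(u,v)=\left(f_1(u),\ f_2(u),\ \lambda\cos\left(\tfrac{u}{c}\right)\cos v,\ \lambda\cos\left(\tfrac{u}{c}\right)\sin v\right),\qquad u\in I,\ v\in\mathbb{R},$$ where $$f_1(u)=\int\sqrt{1-\tfrac{\lambda^2}{c^2}\sin^2\left(\tfrac{u}{c}\right)}\,\cos\alpha(u)\,du,\qquad f_2(u)=\int\sqrt{1-\tfrac{\lambda^2}{c^2}\sin^2\left(\tfrac{u}{c}\right)}\,\sin\alpha(u)\,du$$ (any antiderivatives). For a regular patch in $\mathbb{E}^4$ with first fundamental form coefficients $g_{11}=\langle X_u,X_u\rangle$, $g_{12}=\langle X_u,X_v\rangle$, $g_{22}=\langle X_v,X_v\rangle$, $W^2=g_{11}g_{22}-g_{12}^2\neq0$, orthonormal normal frame $N_1,N_2$ and $L_{11}^k=\langle X_{uu},N_k\rangle$, $L_{12}^k=\langle X_{uv},N_k\rangle$, $L_{22}^k=\langle X_{vv},N_k\rangle$, the Gaussian curvature is $K=\frac{1}{W^2}\sum_{k=1}^{2}\left(L_{11}^kL_{22}^k-(L_{12}^k)^2\right)$.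 *)

theory Defs
  imports "HOL-Analysis.Analysis"
begin

definition smooth_on :: "real set \<Rightarrow> (real \<Rightarrow> real) \<Rightarrow> bool" where
  "smooth_on I f \<longleftrightarrow> (\<forall>n. \<forall>u\<in>I. (deriv ^^ n) f field_differentiable (at u))"
  (* Meant for open I, so that the iterated derivatives on I do not depend on f outside I. *)

definition partial_u :: "(real \<Rightarrow> real \<Rightarrow> 'a::real_normed_vector) \<Rightarrow> real \<Rightarrow> real \<Rightarrow> 'a" where
  "partial_u X u v = vector_derivative (\<lambda>s. X s v) (at u)"

definition partial_v :: "(real \<Rightarrow> real \<Rightarrow> 'a::real_normed_vector) \<Rightarrow> real \<Rightarrow> real \<Rightarrow> 'a" where
  "partial_v X u v = vector_derivative (\<lambda>t. X u t) (at v)"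

definition W_sq :: "(real \<Rightarrow> real \<Rightarrow> 'a::real_inner) \<Rightarrow> real \<Rightarrow> real \<Rightarrow> real" where
  "W_sq X u v =
    (let g11 = partial_u X u v \<bullet> partial_u X u v;
         g12 = partial_u X u v \<bullet> partial_v X u v;
         g22 = partial_v X u v \<bullet> partial_v X u v
     in g11 * g22 - g12\<^sup>2)"

definition C1_patch :: "(real \<times> real) set \<Rightarrow> (real \<Rightarrow> real \<Rightarrow> 'a::real_normed_vector) \<Rightarrow> bool" where
  "C1_patch D X \<longleftrightarrow>
    (\<forall>(u, v)\<in>D. (\<lambda>s. X s v) differentiable (at u) \<and> (\<lambda>t. X u t) differentiable (at v)) \<and>
    continuous_on D (\<lambda>(u, v). partial_u X u v) \<and>
    continuous_on D (\<lambda>(u, v). partial_v X u v)"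

(* Class C2, which is what the second fundamental form needs; in particular every
   vector_derivative occurring in the curvature is a genuine derivative. *)
definition regular_patch :: "(real \<times> real) set \<Rightarrow> (real \<Rightarrow> real \<Rightarrow> 'a::real_inner) \<Rightarrow> bool" where
  "regular_patch D X \<longleftrightarrow>
    open D \<and> C1_patch D X \<and> C1_patch D (partial_u X) \<and> C1_patch D (partial_v X) \<and>
    (\<forall>(u, v)\<in>D. W_sq X u v \<noteq> 0)"

definition normal_frame ::
    "(real \<Rightarrow> real \<Rightarrow> real^4) \<Rightarrow> real \<Rightarrow> real \<Rightarrow> real^4 \<Rightarrow> real^4 \<Rightarrow> bool" where
  "normal_frame X u v N1 N2 \<longleftrightarrow>
    norm N1 = 1 \<and> norm N2 = 1 \<and> N1 \<bullet> N2 = 0 \<and>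
    (\<forall>N\<in>{N1, N2}. N \<bullet> partial_u X u v = 0 \<and> N \<bullet> partial_v X u v = 0)"

(* The k-th summand L11^k L22^k - (L12^k)^2 for N = N_k; note that
   X_uv = partial_v (partial_u X). *)
definition second_form_det ::
    "(real \<Rightarrow> real \<Rightarrow> real^4) \<Rightarrow> real \<Rightarrow> real \<Rightarrow> real^4 \<Rightarrow> real" where
  "second_form_det X u v N =
    (let L11 = partial_u (partial_u X) u v \<bullet> N;
         L12 = partial_v (partial_u X) u v \<bullet> N;
         L22 = partial_v (partial_v X) u v \<bullet> N
     in L11 * L22 - L12\<^sup>2)"

(* The curvature does not depend on the orthonormal normal frame; the definition asks for
   the value K for every frame, and for a frame to exist so that this is not vacuous. *)
definition has_gaussian_curvature ::
    "(real \<Rightarrow> real \<Rightarrow> real^4) \<Rightarrow> real \<Rightarrow> real \<Rightarrow> real \<Rightarrow> bool" where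
  "has_gaussian_curvature X u v K \<longleftrightarrow>
    (\<exists>N1 N2. normal_frame X u v N1 N2) \<and>
    (\<forall>N1 N2. normal_frame X u v N1 N2 \<longrightarrow>
      K = 1 / W_sq X u v * (second_form_det X u v N1 + second_form_det X u v N2))"

definition gen_spherical_patch ::
    "real \<Rightarrow> real \<Rightarrow> (real \<Rightarrow> real) \<Rightarrow> (real \<Rightarrow> real) \<Rightarrow> real \<Rightarrow> real \<Rightarrow> real^4" where
  "gen_spherical_patch c l f1 f2 u v =
    vector [f1 u, f2 u, l * cos (u / c) * cos v, l * cos (u / c) * sin v]"

end

theory Submission
  imports Defs
begin

text \<open>
  The normal components that enter the curvature recombine into one inner product of second
  derivatives, so no normal frame has to be computed to find its value. Write
  \<open>h u = l cos (u / c)\<close> for the signed radius of the circle swept out in the last two coordinates, and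
  \<open>F = sqrt (1 - h'\<^sup>2)\<close>. The square root in the definition of \<open>f1\<close> and \<open>f2\<close> is there to give the
  profile curve unit speed, so \<open>X\<^sub>u\<close> is a unit vector, orthogonal to \<open>X\<^sub>v\<close>, and
  \<open>W\<^sup>2 = \<bar>X\<^sub>v\<bar>\<^sup>2 = h\<^sup>2\<close>. The curves \<open>v = const\<close> are geodesics: \<open>X\<^sub>u\<^sub>u\<close> is normal to the surface. Moreover
  \<open>X\<^sub>u\<^sub>v\<close> is a multiple of \<open>X\<^sub>v\<close>, so both coefficients \<open>L\<^sub>1\<^sub>2\<close> vanish. Parseval's identity in the
  orthonormal basis \<open>X\<^sub>u, X\<^sub>v / \<bar>X\<^sub>v\<bar>, N\<^sub>1, N\<^sub>2\<close> therefore turns the sum of the products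
  \<open>L\<^sub>1\<^sub>1 L\<^sub>2\<^sub>2\<close> into the single inner product of \<open>X\<^sub>u\<^sub>u\<close> and \<open>X\<^sub>v\<^sub>v\<close>, whatever the normal frame is
  (lemma \<open>has_gaussian_curvature_orthogonal_patch\<close>). This product is \<open>- h h''\<close>: as \<open>X\<^sub>v\<^sub>v\<close>
  has no component in the first two coordinates, \<open>\<alpha>\<close> drops out and
  \<open>K = - h'' / h\<close>, as for a classical surface of revolution. Finally \<open>h'' = - h / c\<^sup>2\<close>.
\<close>

section \<open>Curves in four-dimensional space given by coordinates\<close>

text \<open>In this form, derivatives and continuity of a vector given by its coordinates follow from
  the rules for sums and scalar multiples.\<close>

lemma vector_4_eq_axis_combination:
  "(vector [a, b, c, d] :: real^4) =
    a *\<^sub>R axis 1 1 + b *\<^sub>R axis 2 1 + c *\<^sub>R axis 3 1 + d *\<^sub>R axis 4 1"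
  by (simp add: vec_eq_iff forall_4 axis_def vector_def)

lemma has_vector_derivative_vector_4:
  assumes "(a has_real_derivative a') (at x within S)" "(b has_real_derivative b') (at x within S)"
    and "(c has_real_derivative c') (at x within S)" "(d has_real_derivative d') (at x within S)"
  shows "((\<lambda>s. vector [a s, b s, c s, d s] :: real^4)
    has_vector_derivative vector [a', b', c', d']) (at x within S)"
  unfolding vector_4_eq_axis_combination by (auto intro!: derivative_eq_intros assms)

lemma continuous_on_vector_4:
  assumes "continuous_on D a" "continuous_on D b" "continuous_on D c" "continuous_on D d"
  shows "continuous_on D (\<lambda>x. vector [a x, b x, c x, d x] :: real^4)"
  unfolding vector_4_eq_axis_combination by (intro continuous_intros assms)

lemma inner_vector_4:
  "(vector [a, b, c, d] :: real^4) \<bullet> vector [a', b', c', d'] = a * a' + b * b' + c * c' + d * d'"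
  by (simp add: inner_vec_def sum_4 vector_def)

section \<open>Partial derivatives known on an open set\<close>

text \<open>
  The partial derivatives \<open>partial_u\<close> and \<open>partial_v\<close> of a patch agree with closed formulas only on
  the domain of the patch. As the domain is open, this is enough to differentiate once more: it
  contains a neighbourhood of each of its points along both coordinate lines. So the
  lemmas apply to second derivatives, with a first partial derivative for \<open>X\<close> and its formula
  for \<open>Y\<close>.
\<close>

lemma
  fixes X Y P Q :: "real \<Rightarrow> real \<Rightarrow> 'a::real_normed_vector"
  assumes D: "open D"
    and eq: "\<And>u v. (u, v) \<in> D \<Longrightarrow> X u v = Y u v"
    and P: "\<And>u v. (u, v) \<in> D \<Longrightarrow> ((\<lambda>s. Y s v) has_vector_derivative P u v) (at u)"
    and Q: "\<And>u v. (u, v) \<in> D \<Longrightarrow> ((\<lambda>t. Y u t) has_vector_derivative Q u v) (at v)"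
  shows partial_u_cong: "\<And>u v. (u, v) \<in> D \<Longrightarrow> partial_u X u v = P u v"
    and partial_v_cong: "\<And>u v. (u, v) \<in> D \<Longrightarrow> partial_v X u v = Q u v"
    and C1_patch_cong: "continuous_on D (\<lambda>(u, v). P u v) \<Longrightarrow> continuous_on D (\<lambda>(u, v). Q u v)
      \<Longrightarrow> C1_patch D X"
proof -
  have PX: "((\<lambda>s. X s v) has_vector_derivative P u v) (at u)" if "(u, v) \<in> D" for u v
  proof (rule has_vector_derivative_transform_within_open[OF P[OF that]])
    show "open ((\<lambda>s. (s, v)) -` D)" by (intro open_vimage D continuous_intros)
  qed (use that eq in auto)
  have QX: "((\<lambda>t. X u t) has_vector_derivative Q u v) (at v)" if "(u, v) \<in> D" for u v
  proof (rule has_vector_derivative_transform_within_open[OF Q[OF that]])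
    show "open ((\<lambda>t. (u, t)) -` D)" by (intro open_vimage D continuous_intros)
  qed (use that eq in auto)
  show pu: "partial_u X u v = P u v" if "(u, v) \<in> D" for u v
    unfolding partial_u_def by (rule vector_derivative_at[OF PX[OF that]])
  show pv: "partial_v X u v = Q u v" if "(u, v) \<in> D" for u v
    unfolding partial_v_def by (rule vector_derivative_at[OF QX[OF that]])
  assume "continuous_on D (\<lambda>(u, v). P u v)" "continuous_on D (\<lambda>(u, v). Q u v)"
  moreover have "continuous_on D (\<lambda>(u, v). partial_u X u v) = continuous_on D (\<lambda>(u, v). P u v)"
    "continuous_on D (\<lambda>(u, v). partial_v X u v) = continuous_on D (\<lambda>(u, v). Q u v)"
    by (auto intro!: continuous_on_cong simp: pu pv)
  ultimately show "C1_patch D X"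
    using PX QX unfolding C1_patch_def by (force intro: differentiableI_vector)
qed

section \<open>Gaussian curvature in orthogonal coordinates\<close>

lemma inner_eq_sum_orthonormal_basis:
  fixes x y :: "'a::euclidean_space"
  assumes orth: "pairwise orthogonal B" and unit: "\<And>b. b \<in> B \<Longrightarrow> norm b = 1"
    and card: "card B = DIM('a)"
  shows "x \<bullet> y = (\<Sum>b\<in>B. (x \<bullet> b) * (y \<bullet> b))"
proof -
  have fin: "finite B" using card by (metis DIM_positive card.infinite less_irrefl)
  have "independent B" using pairwise_orthogonal_independent[OF orth] unit by fastforce
  then have "x \<in> span B"
    using card_ge_dim_independent[of B UNIV] card by (auto simp: dim_UNIV)
  then have "(\<Sum>b\<in>B. (x \<bullet> b) *\<^sub>R b) = x"
    by (intro orthonormal_basis_expand orth unit fin)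
  then have "x \<bullet> y = (\<Sum>b\<in>B. (x \<bullet> b) *\<^sub>R b) \<bullet> y" by simp
  also have "\<dots> = (\<Sum>b\<in>B. (x \<bullet> b) * (y \<bullet> b))"
    by (simp add: inner_sum_left inner_commute[of y])
  finally show ?thesis .
qed

lemma inner_eq_sum_orthonormal_quadruple:
  fixes x y e1 e2 e3 e4 :: "real^4"
  assumes n: "norm e1 = 1" "norm e2 = 1" "norm e3 = 1" "norm e4 = 1"
    and o: "e1 \<bullet> e2 = 0" "e1 \<bullet> e3 = 0" "e1 \<bullet> e4 = 0" "e2 \<bullet> e3 = 0" "e2 \<bullet> e4 = 0" "e3 \<bullet> e4 = 0"
  shows "x \<bullet> y = (x \<bullet> e1) * (y \<bullet> e1) + (x \<bullet> e2) * (y \<bullet> e2) + (x \<bullet> e3) * (y \<bullet> e3) + (x \<bullet> e4) * (y \<bullet> e4)"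
proof -
  have d: "e1 \<noteq> e2" "e1 \<noteq> e3" "e1 \<noteq> e4" "e2 \<noteq> e3" "e2 \<noteq> e4" "e3 \<noteq> e4"
    using n o by auto
  have "pairwise orthogonal {e1, e2, e3, e4}"
    using o by (auto simp: pairwise_def orthogonal_def inner_commute)
  then have "x \<bullet> y = (\<Sum>b\<in>{e1, e2, e3, e4}. (x \<bullet> b) * (y \<bullet> b))"
    using n d by (intro inner_eq_sum_orthonormal_basis) auto
  then show ?thesis using d by simp
qed

text \<open>
  Parseval's identity for the adapted basis splits the inner product of \<open>X\<^sub>u\<^sub>u\<close> and \<open>X\<^sub>v\<^sub>v\<close> into two
  tangential terms, which vanish because \<open>X\<^sub>u\<^sub>u\<close> is normal, and two normal terms, the
  products \<open>L\<^sub>1\<^sub>1 L\<^sub>2\<^sub>2\<close>. Since \<open>X\<^sub>u\<^sub>v\<close> is tangential, no \<open>L\<^sub>1\<^sub>2\<close> contributes. One frame has to be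
  supplied because the definition of the curvature requires that a frame exists.
\<close>

lemma has_gaussian_curvature_orthogonal_patch:
  fixes X :: "real \<Rightarrow> real \<Rightarrow> real^4"
  defines "Xu \<equiv> partial_u X" and "Xv \<equiv> partial_v X"
  assumes frame: "normal_frame X u v M1 M2"
    and unit: "norm (Xu u v) = 1" and orth: "Xu u v \<bullet> Xv u v = 0" and nz: "Xv u v \<noteq> 0"
    and uuu: "partial_u Xu u v \<bullet> Xu u v = 0" and uuv: "partial_u Xu u v \<bullet> Xv u v = 0"
    and uv: "partial_v Xu u v = k *\<^sub>R Xv u v"
  shows "has_gaussian_curvature X u v
    ((partial_u Xu u v \<bullet> partial_v Xv u v) / (Xv u v \<bullet> Xv u v))"
proof -
  have W: "W_sq X u v = Xv u v \<bullet> Xv u v"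
    using unit orth by (simp add: W_sq_def Xu_def Xv_def norm_eq_1)
  have "(partial_u Xu u v \<bullet> partial_v Xv u v) =
      second_form_det X u v N1 + second_form_det X u v N2"
    if N: "normal_frame X u v N1 N2" for N1 N2
  proof -
    have "partial_u Xu u v \<bullet> partial_v Xv u v =
      (partial_u Xu u v \<bullet> Xu u v) * (partial_v Xv u v \<bullet> Xu u v) +
      (partial_u Xu u v \<bullet> sgn (Xv u v)) * (partial_v Xv u v \<bullet> sgn (Xv u v)) +
      (partial_u Xu u v \<bullet> N1) * (partial_v Xv u v \<bullet> N1) +
      (partial_u Xu u v \<bullet> N2) * (partial_v Xv u v \<bullet> N2)"
      using N unit orth nz
      by (intro inner_eq_sum_orthonormal_quadruple)
        (auto simp: normal_frame_def norm_sgn sgn_div_norm inner_commute Xu_def Xv_def)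
    moreover have "Xv u v \<bullet> N1 = 0" "Xv u v \<bullet> N2 = 0"
      using N by (auto simp: normal_frame_def Xv_def inner_commute)
    ultimately show ?thesis
      using uuu uuv uv by (simp add: second_form_det_def sgn_div_norm Xu_def Xv_def)
  qed
  then show ?thesis
    unfolding has_gaussian_curvature_def W using frame by auto
qed

section \<open>Generalized spherical surfaces of first kind\<close>

theorem proposition6:
  fixes c l :: real and I :: "real set" and \<alpha> f1 f2 :: "real \<Rightarrow> real"
  assumes "c \<noteq> 0" and "l > 0"
    and "open I" and "is_interval I"
    and "\<And>u. u \<in> I \<Longrightarrow> cos (u / c) \<noteq> 0"
    and "\<And>u. u \<in> I \<Longrightarrow> 1 - l\<^sup>2 / c\<^sup>2 * (sin (u / c))\<^sup>2 > 0"
    and "smooth_on I \<alpha>"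
    and "\<And>u. u \<in> I \<Longrightarrow>
      (f1 has_real_derivative sqrt (1 - l\<^sup>2 / c\<^sup>2 * (sin (u / c))\<^sup>2) * cos (\<alpha> u)) (at u)"
    and "\<And>u. u \<in> I \<Longrightarrow>
      (f2 has_real_derivative sqrt (1 - l\<^sup>2 / c\<^sup>2 * (sin (u / c))\<^sup>2) * sin (\<alpha> u)) (at u)"
  shows "regular_patch (I \<times> UNIV) (gen_spherical_patch c l f1 f2) \<and>
    (\<forall>u\<in>I. \<forall>v. has_gaussian_curvature (gen_spherical_patch c l f1 f2) u v (1 / c\<^sup>2))"
proof -
  define X where "X = gen_spherical_patch c l f1 f2"
  define F where "F u = sqrt (1 - l\<^sup>2 / c\<^sup>2 * (sin (u / c))\<^sup>2)" for u
  define F' where "F' u = - (l\<^sup>2 / c^3 * sin (u / c) * cos (u / c)) / F u" for u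
  define h where "h u = l * cos (u / c)" for u
  define h' where "h' u = - (l / c) * sin (u / c)" for u
  define h'' where "h'' u = - h u / c\<^sup>2" for u
  define D :: "(real \<times> real) set" where "D = I \<times> UNIV"
  have D: "open D" unfolding D_def by (intro open_Times assms open_UNIV)
  have mem: "u \<in> I" if "(u, v) \<in> D" for u v using that by (simp add: D_def)
  have Fpos: "F u > 0" if "u \<in> I" for u using assms(6)[OF that] by (simp add: F_def)
  have h_nz: "h u \<noteq> 0" if "u \<in> I" for u using assms(2,5) that by (auto simp: h_def)
  have unit_speed: "(F u)\<^sup>2 + (h' u)\<^sup>2 = 1" if "u \<in> I" for u
    using assms(6)[OF that] by (simp add: F_def h'_def power_mult_distrib power_divide)

  have dh: "(h has_real_derivative h' u) (at u)"
    and dh': "(h' has_real_derivative h'' u) (at u)" for u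
    unfolding h_def h'_def h''_def using assms(1)
    by (auto intro!: derivative_eq_intros simp: field_simps power2_eq_square)
  have dF: "(F has_real_derivative F' u) (at u)" if "u \<in> I" for u
    unfolding F_def F'_def using assms(1) assms(6)[OF that]
    by (auto intro!: derivative_eq_intros simp: field_simps power2_eq_square power3_eq_cube)
  have df: "(f1 has_real_derivative F u * cos (\<alpha> u)) (at u)"
    "(f2 has_real_derivative F u * sin (\<alpha> u)) (at u)" if "u \<in> I" for u
    unfolding F_def by (fact assms(8,9)[OF that])+
  have d\<alpha>: "(\<alpha> has_real_derivative deriv \<alpha> u) (at u)" if "u \<in> I" for u
    using assms(7)[unfolded smooth_on_def, rule_format, of u 0] that
    by (simp add: field_differentiable_derivI)
  have cont_deriv_\<alpha>: "continuous_on I (deriv \<alpha>)"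
    using assms(7)[unfolded smooth_on_def, rule_format, of _ 1]
    by (auto intro!: continuous_at_imp_continuous_on field_differentiable_imp_continuous_at)
  have cont: "continuous_on I \<alpha>" "continuous_on I F" "continuous_on I h" "continuous_on I h'"
    "continuous_on I h''"
    unfolding h''_def using assms(1)
    by (auto intro!: continuous_at_imp_continuous_on continuous_intros DERIV_isCont[OF dh]
        DERIV_isCont[OF dh'] DERIV_isCont[OF dF] DERIV_isCont[OF d\<alpha>])
  have cont_F': "continuous_on I F'"
    unfolding F'_def using assms(1) Fpos
    by (intro continuous_intros cont) force+
  have cont_u: "continuous_on D (\<lambda>x. g (fst x))" if "continuous_on I g" for g :: "real \<Rightarrow> real"
    by (rule continuous_on_compose2[OF that]) (auto simp: D_def intro!: continuous_intros)
  note conts = cont[THEN cont_u] cont_F'[THEN cont_u] cont_deriv_\<alpha>[THEN cont_u]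

  define Xu :: "real \<Rightarrow> real \<Rightarrow> real^4" where
    "Xu u v = vector [F u * cos (\<alpha> u), F u * sin (\<alpha> u), h' u * cos v, h' u * sin v]" for u v
  define Xv :: "real \<Rightarrow> real \<Rightarrow> real^4" where
    "Xv u v = vector [0, 0, - h u * sin v, h u * cos v]" for u v
  define Xuu :: "real \<Rightarrow> real \<Rightarrow> real^4" where
    "Xuu u v = vector [F' u * cos (\<alpha> u) - F u * deriv \<alpha> u * sin (\<alpha> u),
      F' u * sin (\<alpha> u) + F u * deriv \<alpha> u * cos (\<alpha> u), h'' u * cos v, h'' u * sin v]" for u v
  define Xuv :: "real \<Rightarrow> real \<Rightarrow> real^4" where
    "Xuv u v = vector [0, 0, - h' u * sin v, h' u * cos v]" for u v
  define Xvv :: "real \<Rightarrow> real \<Rightarrow> real^4" where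
    "Xvv u v = vector [0, 0, - h u * cos v, - h u * sin v]" for u v

  have X: "X u v = vector [f1 u, f2 u, h u * cos v, h u * sin v]" for u v
    by (simp add: X_def gen_spherical_patch_def h_def)
  have X_u: "((\<lambda>s. X s v) has_vector_derivative Xu u v) (at u)"
    and Xu_u: "((\<lambda>s. Xu s v) has_vector_derivative Xuu u v) (at u)"
    and Xv_u: "((\<lambda>s. Xv s v) has_vector_derivative Xuv u v) (at u)"
    and X_v: "((\<lambda>t. X u t) has_vector_derivative Xv u v) (at v)"
    and Xu_v: "((\<lambda>t. Xu u t) has_vector_derivative Xuv u v) (at v)"
    and Xv_v: "((\<lambda>t. Xv u t) has_vector_derivative Xvv u v) (at v)"
    if "(u, v) \<in> D" for u v
    unfolding X Xu_def Xv_def Xuu_def Xuv_def Xvv_def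
    by (auto intro!: has_vector_derivative_vector_4 derivative_eq_intros
        df dh dh' dF d\<alpha> mem[OF that])
  have cont_vec: "continuous_on D (\<lambda>(u, v). Xu u v)" "continuous_on D (\<lambda>(u, v). Xv u v)"
    "continuous_on D (\<lambda>(u, v). Xuu u v)" "continuous_on D (\<lambda>(u, v). Xuv u v)"
    "continuous_on D (\<lambda>(u, v). Xvv u v)"
    unfolding Xu_def Xv_def Xuu_def Xuv_def Xvv_def case_prod_beta
    by (intro continuous_on_vector_4 continuous_intros conts)+
  have pu: "partial_u X u v = Xu u v" and pv: "partial_v X u v = Xv u v" if "(u, v) \<in> D" for u v
    using partial_u_cong[OF D refl X_u X_v that] partial_v_cong[OF D refl X_u X_v that] by blast+
  have puu: "partial_u (partial_u X) u v = Xuu u v"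
    and puv: "partial_v (partial_u X) u v = Xuv u v" if "(u, v) \<in> D" for u v
    using partial_u_cong[OF D pu Xu_u Xu_v that] partial_v_cong[OF D pu Xu_u Xu_v that] by blast+
  have pvv: "partial_v (partial_v X) u v = Xvv u v" if "(u, v) \<in> D" for u v
    by (rule partial_v_cong[OF D pv Xv_u Xv_v that])

  have ip: "Xu u v \<bullet> Xu u v = 1" "Xu u v \<bullet> Xv u v = 0" "Xv u v \<bullet> Xv u v = (h u)\<^sup>2"
    "Xuu u v \<bullet> Xv u v = 0" "Xuu u v \<bullet> Xvv u v = - h u * h'' u" if "(u, v) \<in> D" for u v
  proof -
    have "Xu u v \<bullet> Xu u v = (F u)\<^sup>2 * ((sin (\<alpha> u))\<^sup>2 + (cos (\<alpha> u))\<^sup>2)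
        + (h' u)\<^sup>2 * ((sin v)\<^sup>2 + (cos v)\<^sup>2)"
      unfolding Xu_def inner_vector_4 by algebra
    then show "Xu u v \<bullet> Xu u v = 1" using unit_speed[OF mem[OF that]] by simp
    have "Xv u v \<bullet> Xv u v = (h u)\<^sup>2 * ((sin v)\<^sup>2 + (cos v)\<^sup>2)"
      unfolding Xv_def inner_vector_4 by algebra
    then show "Xv u v \<bullet> Xv u v = (h u)\<^sup>2" by simp
    have "Xuu u v \<bullet> Xvv u v = - h u * h'' u * ((sin v)\<^sup>2 + (cos v)\<^sup>2)"
      unfolding Xuu_def Xvv_def inner_vector_4 by algebra
    then show "Xuu u v \<bullet> Xvv u v = - h u * h'' u" by simp
    show "Xu u v \<bullet> Xv u v = 0" "Xuu u v \<bullet> Xv u v = 0"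
      unfolding Xu_def Xv_def Xuu_def inner_vector_4 by algebra+
  qed
  have uuu: "Xuu u v \<bullet> Xu u v = 0" if "(u, v) \<in> D" for u v
  proof -
    \<comment> \<open>The acceleration of a unit speed curve is orthogonal to its velocity.\<close>
    have "((\<lambda>s. (F s)\<^sup>2 + (h' s)\<^sup>2) has_real_derivative 2 * (F u * F' u + h' u * h'' u)) (at u)"
      by (auto intro!: derivative_eq_intros dF dh' mem[OF that])
    moreover have "((\<lambda>s. (F s)\<^sup>2 + (h' s)\<^sup>2) has_real_derivative 0) (at u)"
      by (rule has_field_derivative_transform_within_open[OF DERIV_const assms(3) mem[OF that]])
        (simp add: unit_speed)
    ultimately have "F u * F' u + h' u * h'' u = 0"
      using DERIV_unique by fastforce
    moreover have "Xuu u v \<bullet> Xu u v = F u * F' u * ((sin (\<alpha> u))\<^sup>2 + (cos (\<alpha> u))\<^sup>2)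
        + h' u * h'' u * ((sin v)\<^sup>2 + (cos v)\<^sup>2)"
      unfolding Xuu_def Xu_def inner_vector_4 by algebra
    ultimately show ?thesis by simp
  qed
  have W: "W_sq X u v = (h u)\<^sup>2" if "(u, v) \<in> D" for u v
    using that by (simp add: W_sq_def pu pv ip)
  have regular: "regular_patch D X"
    unfolding regular_patch_def
    using D C1_patch_cong[OF D refl X_u X_v] C1_patch_cong[OF D pu Xu_u Xu_v]
      C1_patch_cong[OF D pv Xv_u Xv_v] cont_vec W h_nz mem by auto

  have curvature: "has_gaussian_curvature X u v (1 / c\<^sup>2)" if "u \<in> I" for u v
  proof -
    have uv: "(u, v) \<in> D" using that by (simp add: D_def)
    \<comment> \<open>\<open>X\<^sub>u\<close> is \<open>F\<close> times the unit vector with angle \<open>\<alpha>\<close> in the first coordinate plane plus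
      \<open>h'\<close> times the radial unit vector in the second. \<open>M1\<close> is the former unit vector turned by a
      right angle in the first plane, and \<open>M2\<close> is \<open>X\<^sub>u\<close> turned by a right angle in the plane of
      these two unit vectors.\<close>
    define M1 :: "real^4" where "M1 = vector [- sin (\<alpha> u), cos (\<alpha> u), 0, 0]"
    define M2 :: "real^4" where
      "M2 = vector [h' u * cos (\<alpha> u), h' u * sin (\<alpha> u), - F u * cos v, - F u * sin v]"
    have "M2 \<bullet> M2 = (h' u)\<^sup>2 * ((sin (\<alpha> u))\<^sup>2 + (cos (\<alpha> u))\<^sup>2)
        + (F u)\<^sup>2 * ((sin v)\<^sup>2 + (cos v)\<^sup>2)"
      unfolding M2_def inner_vector_4 by algebra
    then have M2: "M2 \<bullet> M2 = 1" using unit_speed[OF that] by simp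
    have M1: "M1 \<bullet> M1 = 1"
      unfolding M1_def inner_vector_4 by (simp flip: power2_eq_square)
    have "M2 \<bullet> Xu u v = F u * h' u * ((sin (\<alpha> u))\<^sup>2 + (cos (\<alpha> u))\<^sup>2)
        - F u * h' u * ((sin v)\<^sup>2 + (cos v)\<^sup>2)"
      unfolding M2_def Xu_def inner_vector_4 by algebra
    then have M2_Xu: "M2 \<bullet> Xu u v = 0" by simp
    have M: "M1 \<bullet> M2 = 0" "M1 \<bullet> Xu u v = 0" "M1 \<bullet> Xv u v = 0" "M2 \<bullet> Xv u v = 0"
      unfolding M1_def M2_def Xu_def Xv_def inner_vector_4 by algebra+
    have frame: "normal_frame X u v M1 M2"
      using M1 M2 M2_Xu M by (simp add: normal_frame_def norm_eq_1 pu[OF uv] pv[OF uv])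
    have parallel: "Xuv u v = (h' u / h u) *\<^sub>R Xv u v"
      using h_nz[OF that] by (simp add: Xuv_def Xv_def vec_eq_iff forall_4 vector_def)
    have "has_gaussian_curvature X u v ((Xuu u v \<bullet> Xvv u v) / (Xv u v \<bullet> Xv u v))"
      using has_gaussian_curvature_orthogonal_patch[OF frame, of "h' u / h u"]
        ip[OF uv] uuu[OF uv] parallel h_nz[OF that]
      by (simp add: pu[OF uv] pv[OF uv] puu[OF uv] puv[OF uv] pvv[OF uv] norm_eq_1)
         (metis inner_zero_left power_not_zero)
    moreover have "(Xuu u v \<bullet> Xvv u v) / (Xv u v \<bullet> Xv u v) = 1 / c\<^sup>2"
      using h_nz[OF that] by (simp add: ip[OF uv] h''_def power2_eq_square)
    ultimately show ?thesis by simp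
  qed
  show ?thesis
    using regular curvature unfolding X_def D_def by blast
qed

end
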